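(* Every frame $\{x_i\}_{i=1}^m$ for $\mathbb{R}^3$ is piecewise scalable; that is, there exist an orthogonal projection $P:\mathbb{R}^3\to\mathbb{R}^3$ and real constants $\{a_i,b_i\}_{i=1}^m$ such that $\{a_iPx_i+b_i(I-P)x_i\}_{i=1}^m$ is a Parseval frame for $\mathbb{R}^3$.
   Context: A finite family $\{x_i\}_{i=1}^m$ in $\mathbb{R}^n$ is a frame for $\mathbb{R}^n$ if there are constants $0<A\le B<\infty$ with $A\|x\|^2\le\sum_{i=1}^m|\langle x,x_i\rangle|^2\le B\|x\|^2$ for all $x\in\mathbb{R}^n$ (equivalently, the family spans $\mathbb{R}^n$); it is a Parseval frame if $\sum_{i=1}^m|\langle x,x_i\rangle|^2=\|x\|^2$ for all $x\in\mathbb{R}^n$. An orthogonal projection is a linear map $P$ with $P\circ P=P$ and $P^*=P$; $I$ denotes the identity. *)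

theory Defs
  imports "HOL-Analysis.Analysis"
begin

text \<open>A finite family of \<open>m\<close> vectors is a function on \<open>nat\<close> of which only the values
  at the indices \<open>1, \<dots>, m\<close> are used; repeated and zero vectors are allowed.\<close>

definition is_frame :: "nat \<Rightarrow> (nat \<Rightarrow> 'a::euclidean_space) \<Rightarrow> bool" where
  "is_frame m x \<longleftrightarrow>
     (\<exists>A B :: real. 0 < A \<and> A \<le> B \<and>
        (\<forall>v. A * (norm v)\<^sup>2 \<le> (\<Sum>i = 1..m. \<bar>v \<bullet> x i\<bar>\<^sup>2) \<and>
             (\<Sum>i = 1..m. \<bar>v \<bullet> x i\<bar>\<^sup>2) \<le> B * (norm v)\<^sup>2))"

definition is_parseval_frame :: "nat \<Rightarrow> (nat \<Rightarrow> 'a::euclidean_space) \<Rightarrow> bool" where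
  "is_parseval_frame m x \<longleftrightarrow> (\<forall>v. (\<Sum>i = 1..m. \<bar>v \<bullet> x i\<bar>\<^sup>2) = (norm v)\<^sup>2)"

definition is_orthogonal_projection :: "('a::euclidean_space \<Rightarrow> 'a) \<Rightarrow> bool" where
  "is_orthogonal_projection P \<longleftrightarrow> linear P \<and> P \<circ> P = P \<and> adjoint P = P"

definition piecewise_scalable :: "nat \<Rightarrow> (nat \<Rightarrow> 'a::euclidean_space) \<Rightarrow> bool" where
  "piecewise_scalable m x \<longleftrightarrow>
     (\<exists>P. is_orthogonal_projection P \<and>
        (\<exists>a b :: nat \<Rightarrow> real.
           is_parseval_frame m (\<lambda>i. a i *\<^sub>R P (x i) + b i *\<^sub>R (x i - P (x i)))))"

end

theory Submission
  imports Defs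
begin

text \<open>Choose a basis \<open>x\<^sub>i, x\<^sub>j, x\<^sub>k\<close> among the frame vectors and give all other vectors the coefficients
  \<open>0\<close>. With \<open>c = x\<^sub>i \<bullet> x\<^sub>j\<close>, \<open>n = x\<^sub>i \<times> x\<^sub>j\<close> and \<open>s = \<plusminus>1\<close>, the vector
  \<open>u = s(x\<^sub>i + c x\<^sub>j) + n\<close> satisfies \<open>c |u|\<^sup>2 = (x\<^sub>i \<bullet> u) (x\<^sub>j \<bullet> u)\<close>; equivalently, the components of
  \<open>x\<^sub>i\<close> and \<open>x\<^sub>j\<close> orthogonal to \<open>u\<close> are orthogonal to each other. They are nonzero because of the
  \<open>n\<close>-component of \<open>u\<close>, and one of the two signs makes \<open>x\<^sub>k \<bullet> u\<close> nonzero. Let \<open>P\<close> project onto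
  the line of \<open>u\<close>: then \<open>P x\<^sub>k\<close>, \<open>(I - P) x\<^sub>i\<close> and \<open>(I - P) x\<^sub>j\<close> are nonzero and pairwise
  orthogonal, and scaling them to unit length gives an orthonormal basis.\<close>

text \<open>Three orthonormal vectors span by dimension; pairing the expansion of \<open>v\<close>
  in them with \<open>v\<close> itself gives the identity.\<close>

lemma orthonormal3_parseval:
  fixes e f g v :: "real ^ 3"
  assumes "norm e = 1" "norm f = 1" "norm g = 1"
    and "e \<bullet> f = 0" "e \<bullet> g = 0" "f \<bullet> g = 0"
  shows "(v \<bullet> e)\<^sup>2 + (v \<bullet> f)\<^sup>2 + (v \<bullet> g)\<^sup>2 = (norm v)\<^sup>2"
proof -
  let ?B = "{e, f, g}"
  have dist: "e \<noteq> f" "e \<noteq> g" "f \<noteq> g"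
    using assms by (auto simp: norm_eq_1)
  have orth: "pairwise orthogonal ?B"
    using assms by (auto simp: pairwise_def orthogonal_def inner_commute)
  have "0 \<notin> ?B"
    using assms by auto
  then have "independent ?B"
    using orth by (rule pairwise_orthogonal_independent[rotated])
  moreover have "card ?B = dim (UNIV :: (real ^ 3) set)"
    using dist by simp
  ultimately have "UNIV \<subseteq> span ?B"
    using card_ge_dim_independent[of ?B UNIV] by simp
  then have "(\<Sum>b\<in>?B. (v \<bullet> b) *\<^sub>R b) = v"
    using assms orth by (intro orthonormal_basis_expand) auto
  then have "v = (v \<bullet> e) *\<^sub>R e + (v \<bullet> f) *\<^sub>R f + (v \<bullet> g) *\<^sub>R g"
    using dist by (simp add: add.assoc)
  then have "v \<bullet> v = v \<bullet> ((v \<bullet> e) *\<^sub>R e + (v \<bullet> f) *\<^sub>R f + (v \<bullet> g) *\<^sub>R g)"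
    by simp
  then show ?thesis
    unfolding power2_norm_eq_inner by (simp add: inner_add_right power2_eq_square)
qed

lemma orthogonal_projection_line:
  fixes w :: "'a::euclidean_space"
  assumes "norm w = 1"
  shows "is_orthogonal_projection (\<lambda>v. (v \<bullet> w) *\<^sub>R w)"
proof -
  have "adjoint (\<lambda>v. (v \<bullet> w) *\<^sub>R w) = (\<lambda>v. (v \<bullet> w) *\<^sub>R w)"
    by (rule adjoint_unique) (simp add: inner_commute)
  then show ?thesis
    using assms unfolding is_orthogonal_projection_def
    by (auto simp: fun_eq_iff norm_eq_1 inner_add_left scaleR_add_left intro!: linearI)
qed

text \<open>The lower frame bound makes the sum positive, so some summand survives.\<close>

lemma frame_inner_nonzero:
  assumes "is_frame m x" "v \<noteq> 0"
  obtains i where "i \<in> {1..m}" "v \<bullet> x i \<noteq> 0"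
proof -
  obtain A :: real where "0 < A" and A: "A * (norm v)\<^sup>2 \<le> (\<Sum>i = 1..m. \<bar>v \<bullet> x i\<bar>\<^sup>2)"
    using assms(1) unfolding is_frame_def by blast
  then have "0 < A * (norm v)\<^sup>2"
    using assms(2) by simp
  with A have "(\<Sum>i = 1..m. \<bar>v \<bullet> x i\<bar>\<^sup>2) \<noteq> 0"
    by linarith
  then obtain i where "i \<in> {1..m}" "\<bar>v \<bullet> x i\<bar>\<^sup>2 \<noteq> 0"
    by (meson sum.neutral)
  with that show thesis
    by auto
qed

text \<open>Greedy choice: each new frame vector is detected by a nonzero test vector orthogonal to
  those already chosen. The last test vector is the cross product itself.\<close>

lemma frame_obtain_basis:
  fixes x :: "nat \<Rightarrow> real ^ 3"
  assumes "is_frame m x"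
  obtains i j k where "i \<in> {1..m}" "j \<in> {1..m}" "k \<in> {1..m}" "cross3 (x i) (x j) \<bullet> x k \<noteq> 0"
proof -
  \<comment> \<open>Any nonzero test vector would do here; it only ensures
    \<open>x i \<noteq> 0\<close>.\<close>
  have "(axis 1 1 :: real ^ 3) \<noteq> 0"
    by (simp add: axis_eq_0_iff)
  then obtain i where i: "i \<in> {1..m}" "axis 1 1 \<bullet> x i \<noteq> 0"
    using frame_inner_nonzero[OF assms] by blast
  obtain v where v: "v \<noteq> 0" "orthogonal (x i) v"
    using orthogonal_to_vector_exists[of "x i"] by auto
  obtain j where j: "j \<in> {1..m}" "v \<bullet> x j \<noteq> 0"
    using frame_inner_nonzero[OF assms v(1)] by blast
  have "cross3 (x i) (x j) \<noteq> 0"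
  proof
    assume "cross3 (x i) (x j) = 0"
    then have "collinear {0, x i, x j}"
      by (simp add: cross_eq_0)
    then obtain r where "x j = r *\<^sub>R x i"
      using i unfolding collinear_lemma by (metis inner_zero_right scale_zero_left)
    with j v show False
      by (simp add: orthogonal_def inner_commute)
  qed
  with frame_inner_nonzero[OF assms] i j that show thesis
    by blast
qed

lemma exists_projecting_direction:
  fixes p q r :: "real ^ 3"
  assumes "cross3 p q \<bullet> r \<noteq> 0"
  obtains u where "(p \<bullet> q) * (u \<bullet> u) = (p \<bullet> u) * (q \<bullet> u)" "r \<bullet> u \<noteq> 0"
    "\<And>t. p \<noteq> t *\<^sub>R u" "\<And>t. q \<noteq> t *\<^sub>R u"
proof -
  define n where "n = cross3 p q"
  define c where "c = p \<bullet> q"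
  define u where "u s = s *\<^sub>R (p + c *\<^sub>R q) + n" for s :: real
  have n: "p \<bullet> n = 0" "q \<bullet> n = 0" "n \<bullet> p = 0" "n \<bullet> q = 0"
    by (simp_all add: n_def dot_cross_self)
  have nn: "n \<bullet> n = (p \<bullet> p) * (q \<bullet> q) - c\<^sup>2"
    using norm_cross_dot[of p q]
    by (simp add: n_def c_def power_mult_distrib power2_norm_eq_inner)
  have nz: "n \<noteq> 0" "p \<noteq> 0" "q \<noteq> 0"
    using assms by (auto simp: n_def)
  \<comment> \<open>The parts in the plane of \<open>p\<close> and \<open>q\<close> cancel, so
    \<open>r\<close> cannot be orthogonal to both candidates.\<close>
  have "r \<bullet> u 1 + r \<bullet> u (- 1) = 2 * (n \<bullet> r)"
    by (simp add: u_def algebra_simps inner_commute)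
  then have "r \<bullet> u 1 \<noteq> 0 \<or> r \<bullet> u (- 1) \<noteq> 0"
    using assms by (auto simp: n_def)
  then obtain s where s: "s * s = 1" "r \<bullet> u s \<noteq> 0"
    by force
  have pu: "p \<bullet> u s = s * (p \<bullet> p + c * c)" and qu: "q \<bullet> u s = s * (c * (1 + q \<bullet> q))"
    by (simp_all add: u_def n inner_add_right algebra_simps flip: c_def)
       (simp add: c_def inner_commute algebra_simps)
  have "u s \<bullet> u s = s * (p \<bullet> u s) + s * (c * (q \<bullet> u s)) + n \<bullet> n"
    by (simp add: u_def n inner_add_right inner_add_left inner_commute algebra_simps)
  also have "\<dots> = (s * s) * (p \<bullet> p + c * c + c * c * (1 + q \<bullet> q)) + n \<bullet> n"
    by (simp add: pu qu algebra_simps)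
  \<comment> \<open>The \<open>- c\<^sup>2\<close> in \<open>n \<bullet> n\<close> cancels one
    \<open>c * c\<close>, and the rest factors into the same two factors that occur in
    \<open>p \<bullet> u s\<close> and \<open>q \<bullet> u s\<close>.\<close>
  also have "\<dots> = (p \<bullet> p + c * c) * (1 + q \<bullet> q)"
    by (simp add: s nn power2_eq_square algebra_simps)
  finally have uu: "u s \<bullet> u s = (p \<bullet> p + c * c) * (1 + q \<bullet> q)" .
  have "(p \<bullet> u s) * (q \<bullet> u s) = (s * s) * (c * ((p \<bullet> p + c * c) * (1 + q \<bullet> q)))"
    by (simp add: pu qu algebra_simps)
  then have "(p \<bullet> q) * (u s \<bullet> u s) = (p \<bullet> u s) * (q \<bullet> u s)"
    by (simp add: s uu flip: c_def)
  \<comment> \<open>Pairing a multiple of \<open>u s\<close> with \<open>n\<close> leaves only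
    \<open>t * (n \<bullet> n)\<close>, which forces \<open>t = 0\<close>.\<close>
  moreover have "y \<noteq> t *\<^sub>R u s" if "y \<noteq> 0" "y \<bullet> n = 0" for y t
  proof
    assume y: "y = t *\<^sub>R u s"
    then have "t * (n \<bullet> n) = 0"
      using that(2) by (simp add: u_def n inner_add_left)
    then show False
      using nz that(1) y by simp
  qed
  ultimately show thesis
    using that[of "u s"] s nz n by blast
qed

theorem theorem4p1:
  fixes m :: nat and x :: "nat \<Rightarrow> real ^ 3"
  assumes "is_frame m x"
  shows "piecewise_scalable m x"
proof -
  obtain i j k where ijk: "i \<in> {1..m}" "j \<in> {1..m}" "k \<in> {1..m}"
    and indep: "cross3 (x i) (x j) \<bullet> x k \<noteq> 0"
    using frame_obtain_basis[OF assms] by blast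
  have dist: "i \<noteq> j" "i \<noteq> k" "j \<noteq> k"
    using indep by (auto simp: dot_cross_self cross_refl)
  obtain u where orth: "(x i \<bullet> x j) * (u \<bullet> u) = (x i \<bullet> u) * (x j \<bullet> u)"
    and ku: "x k \<bullet> u \<noteq> 0" and iu: "\<And>t. x i \<noteq> t *\<^sub>R u" and ju: "\<And>t. x j \<noteq> t *\<^sub>R u"
    using exists_projecting_direction[OF indep] by blast
  define w where "w = u /\<^sub>R norm u"
  have "u \<noteq> 0"
    using ku by auto
  then have w1: "norm w = 1"
    by (simp add: w_def)
  then have ww: "w \<bullet> w = 1"
    by (simp add: norm_eq_1)
  have kw: "x k \<bullet> w \<noteq> 0"
    using ku \<open>u \<noteq> 0\<close> by (simp add: w_def)
  have ijw: "x i \<bullet> x j = (x i \<bullet> w) * (x j \<bullet> w)"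
    using orth \<open>u \<noteq> 0\<close> by (simp add: w_def field_simps dot_square_norm power2_eq_square)
  define P where "P v = (v \<bullet> w) *\<^sub>R w" for v
  have P: "is_orthogonal_projection P"
    using orthogonal_projection_line[OF w1] by (simp add: P_def[abs_def])
  define y where "y l = x l - P (x l)" for l
  \<comment> \<open>If \<open>y i\<close> vanished, \<open>x i\<close> would equal its projection, a
    multiple of \<open>u\<close>; likewise for \<open>j\<close>.\<close>
  have y0: "y i \<noteq> 0" "y j \<noteq> 0"
    using iu[of "(x i \<bullet> w) / norm u"] ju[of "(x j \<bullet> w) / norm u"]
    by (simp_all add: y_def P_def w_def divide_inverse)
  have yw: "y l \<bullet> w = 0" for l
    by (simp add: y_def P_def inner_diff_left ww)
  have yy: "y i \<bullet> y j = 0"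
    by (simp add: y_def P_def inner_diff_left inner_diff_right ww ijw inner_commute)
  \<comment> \<open>Dividing by the signed inner product makes \<open>z k\<close> equal to
    \<open>w\<close> rather than \<open>w\<close> up to sign.\<close>
  define a where "a l = (if l = k then 1 / (x k \<bullet> w) else 0)" for l
  define b where "b l = (if l = i \<or> l = j then 1 / norm (y l) else 0)" for l
  define z where "z l = a l *\<^sub>R P (x l) + b l *\<^sub>R (x l - P (x l))" for l
  have z: "z i = y i /\<^sub>R norm (y i)" "z j = y j /\<^sub>R norm (y j)" "z k = w"
    using dist kw by (simp_all add: z_def a_def b_def y_def P_def divide_inverse)
  have "(\<Sum>l = 1..m. \<bar>v \<bullet> z l\<bar>\<^sup>2) = (norm v)\<^sup>2" for v
  proof -
    have "(\<Sum>l = 1..m. \<bar>v \<bullet> z l\<bar>\<^sup>2) = (\<Sum>l\<in>{i, j, k}. \<bar>v \<bullet> z l\<bar>\<^sup>2)"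
      using ijk by (intro sum.mono_neutral_right) (auto simp: z_def a_def b_def)
    also have "\<dots> = (v \<bullet> z i)\<^sup>2 + (v \<bullet> z j)\<^sup>2 + (v \<bullet> z k)\<^sup>2"
      using dist by simp
    also have "\<dots> = (norm v)\<^sup>2"
      using y0 yw yy w1 by (intro orthonormal3_parseval) (simp_all add: z)
    finally show ?thesis .
  qed
  then have "is_parseval_frame m (\<lambda>l. a l *\<^sub>R P (x l) + b l *\<^sub>R (x l - P (x l)))"
    by (simp add: is_parseval_frame_def z_def)
  with P show ?thesis
    unfolding piecewise_scalable_def by blast
qed

end
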